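(* Let $X$ be a non-empty compact Hausdorff space, $\sigma:X\to X$ a homeomorphism, and $\Sigma=(X,\sigma)$. The commutant $C(X)'$ of $C(X)$ in $\ell^1(\Sigma)$ is abelian. In fact, it is the largest abelian subalgebra of $\ell^1(\Sigma)$ containing $C(X)$, and it is a commutative unital Banach $^*$-subalgebra of $\ell^1(\Sigma)$.
   Context: Let $\alpha$ be the automorphism of $C(X)$ (continuous complex-valued functions with supremum norm $\|\cdot\|_\infty$) given by $\alpha(f)=f\circ\sigma^{-1}$. The unital Banach $^*$-algebra $\ell^1(\Sigma)$ is the Banach space $\{a:\mathbb Z\to C(X) : \|a\|=\sum_{k\in\mathbb Z}\|a(k)\|_\infty<\infty\}$ with pointwise linear operations, product $(ab)(n)=\sum_{k\in\mathbb Z}a(k)\cdot\alpha^k(b(n-k))$ and involution $a^*(n)=\overline{\alpha^n(a(-n))}$. $C(X)$ is identified with the closed subalgebra of elements supported at $0\in\mathbb Z$. The commutant is $C(X)'=\{a\in\ell^1(\Sigma): af=fa\text{ for all }f\in C(X)\}$. "Largest" means that it contains every abelian subalgebra of $\ell^1(\Sigma)$ that contains $C(X)$. A Banach $^*$-subalgebra is a norm-closed subalgebra that is closed under the involution. *)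

theory Defs
  imports "HOL-Analysis.Analysis"
begin

text \<open>
  The space \<open>X\<close> is modelled by a type \<open>'x :: t2_space\<close> with \<open>compact (UNIV :: 'x set)\<close>; types are
  non-empty. The library type \<open>'x \<Rightarrow>\<^sub>C complex\<close> of bounded continuous functions with the supremum
  norm is then \<open>C(X)\<close>, see \<open>compact_range_apply_bcontfun\<close>.
\<close>

lemma compact_range_apply_bcontfun:
  assumes "compact (UNIV :: 'x::t2_space set)"
  shows "range (apply_bcontfun :: ('x \<Rightarrow>\<^sub>C complex) \<Rightarrow> _) = {f. continuous_on UNIV f}"
proof -
  have "bounded (range f)" if "continuous_on UNIV f" for f :: "'x \<Rightarrow> complex"
    using compact_continuous_image[OF that assms] by (rule compact_imp_bounded)
  moreover have "range (apply_bcontfun :: ('x \<Rightarrow>\<^sub>C complex) \<Rightarrow> _) = bcontfun"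
    using type_definition_bcontfun by (rule type_definition.Rep_range)
  ultimately show ?thesis
    by (auto simp: bcontfun_def)
qed

text \<open>The library proves completeness only over a metric domain.\<close>

instance bcontfun :: (topological_space, complete_space) complete_space
proof
  fix f :: "nat \<Rightarrow> ('a, 'b) bcontfun"
  assume "Cauchy f"
  then obtain g where "uniform_limit UNIV f g sequentially"
    using uniformly_convergent_eq_cauchy[of "\<lambda>_. True" f]
    unfolding Cauchy_def uniform_limit_sequentially_iff
    by (metis dist_fun_lt_imp_dist_val_lt)
  from uniform_limit_bcontfunE[OF this sequentially_bot]
  obtain l' where "g = apply_bcontfun l'" "(f \<longlonglongrightarrow> l')" by metis
  then show "convergent f"
    by (intro convergentI)
qed

instance bcontfun :: (topological_space, banach) banach ..


subsection \<open>Pointwise operations on \<open>C(X)\<close>\<close>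

instantiation bcontfun :: (topological_space, real_normed_algebra) real_normed_algebra
begin

definition times_bcontfun :: "('a \<Rightarrow>\<^sub>C 'b) \<Rightarrow> ('a \<Rightarrow>\<^sub>C 'b) \<Rightarrow> ('a \<Rightarrow>\<^sub>C 'b)"
  where "times_bcontfun f g = Bcontfun (\<lambda>x. f x * g x)"

lemma apply_bcontfun_times [simp]:
  "apply_bcontfun (f * g) x = apply_bcontfun f x * apply_bcontfun g x"
proof -
  have "norm (f x * g x) \<le> norm f * norm g" for x
    by (rule order_trans[OF norm_mult_ineq]) (intro mult_mono norm_bounded norm_ge_zero)
  then have "(\<lambda>x. f x * g x) \<in> bcontfun"
    by (intro bcontfun_normI continuous_intros) auto
  then show ?thesis
    by (simp add: times_bcontfun_def Bcontfun_inverse)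
qed

instance
proof
  fix f g :: "'a \<Rightarrow>\<^sub>C 'b"
  show "norm (f * g) \<le> norm f * norm g"
  proof (rule norm_bound)
    fix x
    show "norm ((f * g) x) \<le> norm f * norm g"
      unfolding apply_bcontfun_times
      by (rule order_trans[OF norm_mult_ineq]) (intro mult_mono norm_bounded norm_ge_zero)
  qed
qed (auto intro!: bcontfun_eqI simp: algebra_simps)

end

instantiation bcontfun :: (topological_space, real_normed_algebra_1) real_normed_algebra_1
begin

definition one_bcontfun :: "'a \<Rightarrow>\<^sub>C 'b"
  where "one_bcontfun = const_bcontfun 1"

lemma apply_bcontfun_one [simp]: "apply_bcontfun 1 x = 1"
  by (simp add: one_bcontfun_def)

instance
proof
  show "(0 :: 'a \<Rightarrow>\<^sub>C 'b) \<noteq> 1"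
    by (metis apply_bcontfun_one zero_bcontfun.rep_eq zero_neq_one)
  have "norm (1 :: 'a \<Rightarrow>\<^sub>C 'b) \<le> 1"
    by (rule norm_bound) simp
  moreover have "1 \<le> norm (1 :: 'a \<Rightarrow>\<^sub>C 'b)"
    using norm_bounded[of "1 :: 'a \<Rightarrow>\<^sub>C 'b" undefined] by simp
  ultimately show "norm (1 :: 'a \<Rightarrow>\<^sub>C 'b) = 1"
    by simp
qed (auto intro!: bcontfun_eqI)

end

instance bcontfun :: (topological_space, "{real_normed_algebra_1, comm_ring_1}") comm_ring_1
  by standard (auto intro!: bcontfun_eqI simp: algebra_simps)

definition cnj_bcontfun :: "('x::t2_space \<Rightarrow>\<^sub>C complex) \<Rightarrow> ('x \<Rightarrow>\<^sub>C complex)"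
  where "cnj_bcontfun f = Bcontfun (\<lambda>x. cnj (f x))"

lemma apply_cnj_bcontfun [simp]: "apply_bcontfun (cnj_bcontfun f) x = cnj (apply_bcontfun f x)"
proof -
  have "(\<lambda>x. cnj (f x)) \<in> bcontfun"
    by (intro bcontfun_normI[where b = "norm f"] continuous_intros) (auto simp: norm_bounded)
  then show ?thesis
    by (simp add: cnj_bcontfun_def Bcontfun_inverse)
qed


subsection \<open>The automorphism \<open>\<alpha>\<close> and its integer powers\<close>

definition \<alpha> :: "('x::t2_space \<Rightarrow> 'x) \<Rightarrow> ('x \<Rightarrow>\<^sub>C complex) \<Rightarrow> ('x \<Rightarrow>\<^sub>C complex)"
  where "\<alpha> \<sigma> f = Bcontfun (apply_bcontfun f \<circ> inv \<sigma>)"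

definition int_funpow :: "('a \<Rightarrow> 'a) \<Rightarrow> int \<Rightarrow> 'a \<Rightarrow> 'a"
  where "int_funpow g k = (if 0 \<le> k then g ^^ nat k else inv g ^^ nat (- k))"

lemma apply_\<alpha>:
  assumes "homeomorphism UNIV UNIV \<sigma> (inv \<sigma>)"
  shows "apply_bcontfun (\<alpha> \<sigma> f) = apply_bcontfun f \<circ> inv \<sigma>"
proof -
  have "continuous_on UNIV (apply_bcontfun f \<circ> inv \<sigma>)"
    using assms by (intro continuous_on_compose) (auto simp: homeomorphism_def)
  moreover have "norm ((apply_bcontfun f \<circ> inv \<sigma>) x) \<le> norm f" for x
    by (simp add: norm_bounded)
  ultimately have "apply_bcontfun f \<circ> inv \<sigma> \<in> bcontfun"
    by (intro bcontfun_normI)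
  then show ?thesis
    by (simp add: \<alpha>_def Bcontfun_inverse)
qed

lemma bij_\<alpha>:
  assumes "homeomorphism UNIV UNIV \<sigma> (inv \<sigma>)"
  shows "bij (\<alpha> \<sigma>)"
proof (rule bijI)
  have \<sigma>: "inv \<sigma> (\<sigma> x) = x" "\<sigma> (inv \<sigma> x) = x" for x
    using assms by (auto simp: homeomorphism_def)
  show "inj (\<alpha> \<sigma>)"
  proof (rule injI)
    fix f g assume "\<alpha> \<sigma> f = \<alpha> \<sigma> g"
    then have "apply_bcontfun f \<circ> inv \<sigma> = apply_bcontfun g \<circ> inv \<sigma>"
      using apply_\<alpha>[OF assms] by metis
    then show "f = g"
      by (intro bcontfun_eqI) (metis \<sigma>(1) comp_apply)
  qed
  show "surj (\<alpha> \<sigma>)"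
  proof (rule surjI)
    fix f :: "'a \<Rightarrow>\<^sub>C complex"
    have "continuous_on UNIV (\<lambda>x. f (\<sigma> x))"
      by (rule continuous_on_compose2[where t = UNIV])
        (use assms in \<open>auto simp: homeomorphism_def\<close>)
    then have "(\<lambda>x. f (\<sigma> x)) \<in> bcontfun"
      by (rule bcontfun_normI[where b = "norm f"]) (simp add: norm_bounded)
    then show "\<alpha> \<sigma> (Bcontfun (\<lambda>x. f (\<sigma> x))) = f"
      by (intro bcontfun_eqI) (simp add: apply_\<alpha>[OF assms] Bcontfun_inverse \<sigma>)
  qed
qed

lemma norm_\<alpha>:
  assumes "homeomorphism UNIV UNIV \<sigma> (inv \<sigma>)"
  shows "norm (\<alpha> \<sigma> f) = norm f"
proof (rule antisym)
  show "norm (\<alpha> \<sigma> f) \<le> norm f"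
    by (rule norm_bound) (simp add: apply_\<alpha>[OF assms] norm_bounded)
  show "norm f \<le> norm (\<alpha> \<sigma> f)"
  proof (rule norm_bound)
    fix x
    have "f x = \<alpha> \<sigma> f (\<sigma> x)"
      using assms by (simp add: apply_\<alpha>[OF assms] homeomorphism_def)
    then show "norm (f x) \<le> norm (\<alpha> \<sigma> f)"
      by (simp add: norm_bounded)
  qed
qed

lemma norm_int_funpow_\<alpha>:
  assumes "homeomorphism UNIV UNIV \<sigma> (inv \<sigma>)"
  shows "norm (int_funpow (\<alpha> \<sigma>) k f) = norm f"
proof -
  have "norm (inv (\<alpha> \<sigma>) g) = norm g" for g
    using norm_\<alpha>[OF assms, of "inv (\<alpha> \<sigma>) g"]
    by (simp add: surj_f_inv_f[OF bij_is_surj[OF bij_\<alpha>[OF assms]]])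
  then have "norm ((inv (\<alpha> \<sigma>) ^^ n) f) = norm f" for n
    by (induction n) auto
  moreover have "norm ((\<alpha> \<sigma> ^^ n) f) = norm f" for n
    by (induction n) (auto simp: norm_\<alpha>[OF assms])
  ultimately show ?thesis
    by (simp add: int_funpow_def)
qed


subsection \<open>The Banach \<open>*\<close>-algebra of the dynamical system\<close>

text \<open>
  The underlying Banach space does not depend on \<open>\<sigma>\<close>, the product and the involution do. Infinite
  sums in the product are taken in the norm of \<open>C(X)\<close>; they converge by
  \<open>ell1_mult_summable\<close>.
\<close>

definition ell1 :: "(int \<Rightarrow> ('x::t2_space \<Rightarrow>\<^sub>C complex)) set"
  where "ell1 = {a. (\<lambda>k. norm (a k)) summable_on UNIV}"

definition ell1_norm :: "(int \<Rightarrow> ('x::t2_space \<Rightarrow>\<^sub>C complex)) \<Rightarrow> real"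
  where "ell1_norm a = (\<Sum>\<^sub>\<infinity>k. norm (a k))"

definition ell1_dist ::
  "(int \<Rightarrow> ('x::t2_space \<Rightarrow>\<^sub>C complex)) \<Rightarrow> (int \<Rightarrow> ('x \<Rightarrow>\<^sub>C complex)) \<Rightarrow> real"
  where "ell1_dist a b = ell1_norm (\<lambda>k. a k - b k)"

definition ell1_mult :: "('x::t2_space \<Rightarrow> 'x) \<Rightarrow>
    (int \<Rightarrow> ('x \<Rightarrow>\<^sub>C complex)) \<Rightarrow> (int \<Rightarrow> ('x \<Rightarrow>\<^sub>C complex)) \<Rightarrow> (int \<Rightarrow> ('x \<Rightarrow>\<^sub>C complex))"
  where "ell1_mult \<sigma> a b = (\<lambda>n. \<Sum>\<^sub>\<infinity>k. a k * int_funpow (\<alpha> \<sigma>) k (b (n - k)))"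

definition ell1_star ::
  "('x::t2_space \<Rightarrow> 'x) \<Rightarrow> (int \<Rightarrow> ('x \<Rightarrow>\<^sub>C complex)) \<Rightarrow> (int \<Rightarrow> ('x \<Rightarrow>\<^sub>C complex))"
  where "ell1_star \<sigma> a = (\<lambda>n. cnj_bcontfun (int_funpow (\<alpha> \<sigma>) n (a (- n))))"

definition ell1_embed :: "('x::t2_space \<Rightarrow>\<^sub>C complex) \<Rightarrow> (int \<Rightarrow> ('x \<Rightarrow>\<^sub>C complex))"
  where "ell1_embed f = (\<lambda>k. if k = 0 then f else 0)"

lemma ell1_diff:
  assumes "a \<in> ell1" "b \<in> ell1"
  shows "(\<lambda>k. norm (a k - b k)) summable_on UNIV"
proof (rule summable_on_comparison_test)
  show "(\<lambda>k. norm (a k) + norm (b k)) summable_on UNIV"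
    using assms by (auto simp: ell1_def intro: summable_on_add)
qed (auto intro: norm_triangle_ineq4)

lemma ell1_Metric_space: "Metric_space ell1 ell1_dist"
proof
  fix a b c :: "int \<Rightarrow> ('a \<Rightarrow>\<^sub>C complex)"
  show "0 \<le> ell1_dist a b"
    by (simp add: ell1_dist_def ell1_norm_def infsum_nonneg)
  show "ell1_dist a b = ell1_dist b a"
    by (simp add: ell1_dist_def ell1_norm_def norm_minus_commute)
  assume a: "a \<in> ell1" and b: "b \<in> ell1"
  show "ell1_dist a b = 0 \<longleftrightarrow> a = b"
  proof
    assume "ell1_dist a b = 0"
    then have "norm (a k - b k) = 0" for k
      unfolding ell1_dist_def ell1_norm_def
      by (intro nonneg_infsum_le_0D[OF _ ell1_diff[OF a b]]) auto
    then show "a = b"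
      by auto
  qed (simp add: ell1_dist_def ell1_norm_def)
  assume c: "c \<in> ell1"
  have "ell1_dist a c \<le> (\<Sum>\<^sub>\<infinity>k. norm (a k - b k) + norm (b k - c k))"
    unfolding ell1_dist_def ell1_norm_def
    by (intro infsum_mono ell1_diff a b c summable_on_add) norm
  also have "\<dots> = ell1_dist a b + ell1_dist b c"
    unfolding ell1_dist_def ell1_norm_def
    by (intro infsum_add ell1_diff a b c)
  finally show "ell1_dist a c \<le> ell1_dist a b + ell1_dist b c" .
qed

lemma
  assumes "homeomorphism UNIV UNIV \<sigma> (inv \<sigma>)" and a: "a \<in> ell1" and b: "b \<in> ell1"
  shows ell1_mult_summable:
      "(\<lambda>k. norm (a k * int_funpow (\<alpha> \<sigma>) k (b (n - k)))) summable_on UNIV"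
    and ell1_mult_mem: "ell1_mult \<sigma> a b \<in> ell1"
proof -
  have "(\<lambda>p. norm (norm (a (fst p)) * norm (b (snd p)))) summable_on (UNIV \<times> UNIV)"
    unfolding Infinite_Sum.abs_summable_on_Sigma_iff
    using a b
    by (simp add: ell1_def abs_mult infsum_nonneg infsum_cmult_right' summable_on_cmult_right summable_on_cmult_left)
  then have prod: "(\<lambda>(k, m). norm (a k) * norm (b m)) summable_on (UNIV \<times> UNIV)"
    by (simp add: case_prod_unfold)
  have bij: "bij_betw (\<lambda>(n, k). (k, n - k)) (UNIV \<times> UNIV) (UNIV \<times> (UNIV :: int set))"
    by (rule bij_betwI[where g = "\<lambda>(k, m). (k + m, k)"]) auto
  have *: "(\<lambda>(n, k). norm (a k) * norm (b (n - k))) summable_on (UNIV \<times> UNIV)"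
    using prod summable_on_reindex_bij_betw[OF bij, of "\<lambda>(k, m). norm (a k) * norm (b m)"]
    by (simp add: case_prod_unfold)
  have bound: "norm (a k * int_funpow (\<alpha> \<sigma>) k (b (n - k))) \<le> norm (a k) * norm (b (n - k))" for n k
    using norm_mult_ineq[of "a k" "int_funpow (\<alpha> \<sigma>) k (b (n - k))"]
    by (simp only: norm_int_funpow_\<alpha>[OF assms(1)])
  have row: "(\<lambda>k. norm (a k) * norm (b (n - k))) summable_on UNIV" for n
    using summable_on_SigmaD1[OF *, of n] by simp
  have sum: "(\<lambda>k. norm (a k * int_funpow (\<alpha> \<sigma>) k (b (n - k)))) summable_on UNIV" for n
    by (rule summable_on_comparison_test[OF row]) (auto intro: bound)
  then show "(\<lambda>k. norm (a k * int_funpow (\<alpha> \<sigma>) k (b (n - k)))) summable_on UNIV" .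
  have le: "norm (ell1_mult \<sigma> a b n) \<le> (\<Sum>\<^sub>\<infinity>k. norm (a k) * norm (b (n - k)))" for n
    unfolding ell1_mult_def
    by (rule order_trans[OF norm_infsum_bound[OF sum]])
      (intro infsum_mono sum row bound)
  have tot: "(\<lambda>n. \<Sum>\<^sub>\<infinity>k. norm (a k) * norm (b (n - k))) summable_on UNIV"
    using summable_on_Sigma_banach[OF *] by simp
  show "ell1_mult \<sigma> a b \<in> ell1"
    unfolding ell1_def mem_Collect_eq
    by (rule summable_on_comparison_test[OF tot]) (auto intro: le)
qed


subsection \<open>Subalgebras\<close>

definition ell1_subalgebra :: "('x::t2_space \<Rightarrow> 'x) \<Rightarrow> (int \<Rightarrow> ('x \<Rightarrow>\<^sub>C complex)) set \<Rightarrow> bool"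
  where "ell1_subalgebra \<sigma> A \<longleftrightarrow>
    A \<subseteq> ell1 \<and> (\<lambda>_. 0) \<in> A \<and>
    (\<forall>a\<in>A. \<forall>b\<in>A. (\<lambda>k. a k + b k) \<in> A) \<and>
    (\<forall>c. \<forall>a\<in>A. (\<lambda>k. const_bcontfun c * a k) \<in> A) \<and>
    (\<forall>a\<in>A. \<forall>b\<in>A. ell1_mult \<sigma> a b \<in> A)"

definition ell1_abelian :: "('x::t2_space \<Rightarrow> 'x) \<Rightarrow> (int \<Rightarrow> ('x \<Rightarrow>\<^sub>C complex)) set \<Rightarrow> bool"
  where "ell1_abelian \<sigma> A \<longleftrightarrow> (\<forall>a\<in>A. \<forall>b\<in>A. ell1_mult \<sigma> a b = ell1_mult \<sigma> b a)"

definition ell1_unital :: "('x::t2_space \<Rightarrow> 'x) \<Rightarrow> (int \<Rightarrow> ('x \<Rightarrow>\<^sub>C complex)) set \<Rightarrow> bool"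
  where "ell1_unital \<sigma> A \<longleftrightarrow>
    (\<exists>e\<in>A. \<forall>a\<in>ell1. ell1_mult \<sigma> e a = a \<and> ell1_mult \<sigma> a e = a)"

definition ell1_Banach_star_subalgebra ::
  "('x::t2_space \<Rightarrow> 'x) \<Rightarrow> (int \<Rightarrow> ('x \<Rightarrow>\<^sub>C complex)) set \<Rightarrow> bool"
  where "ell1_Banach_star_subalgebra \<sigma> A \<longleftrightarrow>
    ell1_subalgebra \<sigma> A \<and>
    closedin (Metric_space.mtopology ell1 ell1_dist) A \<and>
    (\<forall>a\<in>A. ell1_star \<sigma> a \<in> A)"

definition ell1_commutant_CX :: "('x::t2_space \<Rightarrow> 'x) \<Rightarrow> (int \<Rightarrow> ('x \<Rightarrow>\<^sub>C complex)) set"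
  where "ell1_commutant_CX \<sigma> =
    {a \<in> ell1. \<forall>f. ell1_mult \<sigma> a (ell1_embed f) = ell1_mult \<sigma> (ell1_embed f) a}"

definition ell1_largest_abelian_over_CX ::
  "('x::t2_space \<Rightarrow> 'x) \<Rightarrow> (int \<Rightarrow> ('x \<Rightarrow>\<^sub>C complex)) set \<Rightarrow> bool"
  where "ell1_largest_abelian_over_CX \<sigma> A \<longleftrightarrow>
    ell1_subalgebra \<sigma> A \<and> ell1_abelian \<sigma> A \<and> range ell1_embed \<subseteq> A \<and>
    (\<forall>B. ell1_subalgebra \<sigma> B \<and> ell1_abelian \<sigma> B \<and> range ell1_embed \<subseteq> B \<longrightarrow> B \<subseteq> A)"

end

theory Submission
  imports Defs
begin

text \<open>
  Write \<open>\<alpha>\<^sup>n\<close> for \<open>int_funpow (\<alpha> \<sigma>) n\<close>. Comparing the coefficients of \<open>af\<close> and \<open>fa\<close> at \<open>n\<close> shows that an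
  element \<open>a\<close> of \<open>ell1\<close> lies in the commutant of \<open>C(X)\<close> iff \<open>a(n) \<cdot> \<alpha>\<^sup>n(f) = f \<cdot> a(n)\<close> for all \<open>n\<close>
  and \<open>f\<close> (\<open>mem_ell1_commutant_CX_iff\<close>): as far as multiplication by \<open>a(n)\<close> can tell, \<open>\<alpha>\<^sup>n\<close> is the
  identity. In terms of points, \<open>a(n)\<close> is supported on the fixed points of \<open>\<sigma>\<^sup>n\<close>.

  Everything follows from this criterion. If \<open>a\<close> is in the commutant, then the twist disappears from
  the product: \<open>(ab)(n)\<close> is the sum of the \<open>a(k) \<cdot> b(n - k)\<close> (\<open>ell1_mult_commutant_left\<close>). For \<open>b\<close> also
  in the commutant this ordinary convolution is symmetric, so \<open>ab = ba\<close>. The criterion is stable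
  under products and involution because \<open>n \<mapsto> \<alpha>\<^sup>n\<close> is an action of the integers by
  \<open>*\<close>-automorphisms, and it is a closed condition because each coefficient depends continuously
  on \<open>a\<close>. Finally, an abelian subalgebra containing \<open>C(X)\<close> commutes with \<open>C(X)\<close>, so it lies in the
  commutant.
\<close>

section \<open>Integer iterates of a bijection\<close>

lemma int_funpow_0 [simp]: "int_funpow g 0 = id"
  by (simp add: int_funpow_def)

lemma int_funpow_Suc:
  assumes "bij g"
  shows "int_funpow g (k + 1) x = g (int_funpow g k x)"
proof (cases "0 \<le> k")
  case True
  then show ?thesis
    by (simp add: int_funpow_def nat_add_distrib)
next
  case False
  then have "nat (- k) = Suc (nat (- (k + 1)))"
    by linarith
  then have "g (int_funpow g k x) = (inv g ^^ nat (- (k + 1))) x"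
    using False by (simp add: int_funpow_def surj_f_inv_f[OF bij_is_surj[OF assms]])
  also have "\<dots> = int_funpow g (k + 1) x"
    using False by (cases "k = -1") (auto simp: int_funpow_def)
  finally show ?thesis ..
qed

lemma int_funpow_pred:
  assumes "bij g"
  shows "int_funpow g (k - 1) x = inv g (int_funpow g k x)"
  using int_funpow_Suc[OF assms, of "k - 1" x]
  by (simp add: inv_f_f[OF bij_is_inj[OF assms]])

lemma int_funpow_add:
  assumes "bij g"
  shows "int_funpow g (m + n) x = int_funpow g m (int_funpow g n x)"
proof (induction m rule: int_induct[where k = 0])
  case (step1 i)
  then show ?case
    using int_funpow_Suc[OF assms, of "i + n" x] int_funpow_Suc[OF assms, of i]
    by (simp add: algebra_simps)
next
  case (step2 i)
  then show ?case
    using int_funpow_pred[OF assms, of "i + n" x] int_funpow_pred[OF assms, of i]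
    by (simp add: algebra_simps)
qed simp


section \<open>The powers of \<open>\<alpha>\<close> as \<open>*\<close>-automorphisms\<close>

text \<open>
  Every power of \<open>\<alpha>\<close>, also with a negative exponent, is composition with a self-map of the space.
  It therefore respects all pointwise operations.
\<close>

lemma int_funpow_\<alpha>_composition:
  fixes \<sigma> :: "'x::t2_space \<Rightarrow> 'x"
  assumes \<sigma>: "homeomorphism UNIV UNIV \<sigma> (inv \<sigma>)"
  obtains \<tau> where "\<And>f x. apply_bcontfun (int_funpow (\<alpha> \<sigma>) n f) x = apply_bcontfun f (\<tau> x)"
proof -
  note bij = bij_\<alpha>[OF \<sigma>]
  have inv_\<alpha>: "inv (\<alpha> \<sigma>) f x = f (\<sigma> x)" for f x
  proof -
    have "inv (\<alpha> \<sigma>) f x = \<alpha> \<sigma> (inv (\<alpha> \<sigma>) f) (\<sigma> x)"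
      using \<sigma> by (simp add: apply_\<alpha>[OF \<sigma>] homeomorphism_def)
    then show ?thesis
      by (simp add: surj_f_inv_f[OF bij_is_surj[OF bij]])
  qed
  have "\<exists>\<tau>. \<forall>f x. apply_bcontfun (int_funpow (\<alpha> \<sigma>) n f) x = apply_bcontfun f (\<tau> x)"
  proof (induction n rule: int_induct[where k = 0])
    case base
    show ?case
      by (rule exI[of _ id]) simp
  next
    case (step1 i)
    then obtain \<tau> where "\<forall>f x. apply_bcontfun (int_funpow (\<alpha> \<sigma>) i f) x = apply_bcontfun f (\<tau> x)"
      by blast
    then show ?case
      by (intro exI[of _ "\<tau> \<circ> inv \<sigma>"]) (simp add: int_funpow_Suc[OF bij] apply_\<alpha>[OF \<sigma>])
  next
    case (step2 i)
    then obtain \<tau> where "\<forall>f x. apply_bcontfun (int_funpow (\<alpha> \<sigma>) i f) x = apply_bcontfun f (\<tau> x)"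
      by blast
    then show ?case
      by (intro exI[of _ "\<tau> \<circ> \<sigma>"]) (simp add: int_funpow_pred[OF bij] inv_\<alpha>)
  qed
  with that show ?thesis
    by blast
qed

lemma
  fixes \<sigma> :: "'x::t2_space \<Rightarrow> 'x"
  assumes \<sigma>: "homeomorphism UNIV UNIV \<sigma> (inv \<sigma>)"
  shows int_funpow_\<alpha>_zero: "int_funpow (\<alpha> \<sigma>) n 0 = 0"
    and int_funpow_\<alpha>_one: "int_funpow (\<alpha> \<sigma>) n 1 = 1"
    and int_funpow_\<alpha>_mult:
      "int_funpow (\<alpha> \<sigma>) n (f * g) = int_funpow (\<alpha> \<sigma>) n f * int_funpow (\<alpha> \<sigma>) n g"
    and int_funpow_\<alpha>_cnj:
      "int_funpow (\<alpha> \<sigma>) n (cnj_bcontfun f) = cnj_bcontfun (int_funpow (\<alpha> \<sigma>) n f)"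
proof -
  obtain \<tau> where "\<And>f x. apply_bcontfun (int_funpow (\<alpha> \<sigma>) n f) x = apply_bcontfun f (\<tau> x)"
    using int_funpow_\<alpha>_composition[OF \<sigma>] by blast
  then show "int_funpow (\<alpha> \<sigma>) n 0 = 0"
    and "int_funpow (\<alpha> \<sigma>) n 1 = 1"
    and "int_funpow (\<alpha> \<sigma>) n (f * g) = int_funpow (\<alpha> \<sigma>) n f * int_funpow (\<alpha> \<sigma>) n g"
    and "int_funpow (\<alpha> \<sigma>) n (cnj_bcontfun f) = cnj_bcontfun (int_funpow (\<alpha> \<sigma>) n f)"
    by (auto intro!: bcontfun_eqI)
qed

lemma cnj_bcontfun_mult: "cnj_bcontfun (f * g) = cnj_bcontfun f * cnj_bcontfun g"
  by (rule bcontfun_eqI) simp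

lemma cnj_bcontfun_cnj: "cnj_bcontfun (cnj_bcontfun f) = f"
  by (rule bcontfun_eqI) simp

lemma norm_cnj_bcontfun: "norm (cnj_bcontfun f) = norm f"
proof -
  have le: "norm (cnj_bcontfun g) \<le> norm g" for g :: "'a \<Rightarrow>\<^sub>C complex"
    by (rule norm_bound) (simp add: norm_bounded)
  show ?thesis
    using le[of f] le[of "cnj_bcontfun f"] by (simp add: cnj_bcontfun_cnj)
qed


section \<open>The coefficients of an element of the commutant\<close>

lemma ell1_embed_mem: "ell1_embed f \<in> ell1"
proof -
  have "(\<lambda>k. norm (ell1_embed f k)) summable_on {0}"
    by simp
  then show ?thesis
    unfolding ell1_def mem_Collect_eq
    by (rule summable_on_cong_neutral[THEN iffD1, rotated -1]) (auto simp: ell1_embed_def)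
qed

lemma ell1_mult_embed_right:
  assumes "homeomorphism UNIV UNIV \<sigma> (inv \<sigma>)"
  shows "ell1_mult \<sigma> a (ell1_embed f) n = a n * int_funpow (\<alpha> \<sigma>) n f"
proof -
  have "ell1_mult \<sigma> a (ell1_embed f) n =
      (\<Sum>\<^sub>\<infinity>k\<in>{n}. a k * int_funpow (\<alpha> \<sigma>) k (ell1_embed f (n - k)))"
    unfolding ell1_mult_def
    by (rule infsum_cong_neutral) (auto simp: ell1_embed_def int_funpow_\<alpha>_zero[OF assms])
  then show ?thesis
    by (simp add: ell1_embed_def)
qed

lemma ell1_mult_embed_left: "ell1_mult \<sigma> (ell1_embed f) a n = f * a n"
proof -
  have "ell1_mult \<sigma> (ell1_embed f) a n =
      (\<Sum>\<^sub>\<infinity>k\<in>{0}. ell1_embed f k * int_funpow (\<alpha> \<sigma>) k (a (n - k)))"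
    unfolding ell1_mult_def by (rule infsum_cong_neutral) (auto simp: ell1_embed_def)
  then show ?thesis
    by (simp add: ell1_embed_def)
qed

lemma mem_ell1_commutant_CX_iff:
  assumes "homeomorphism UNIV UNIV \<sigma> (inv \<sigma>)"
  shows "a \<in> ell1_commutant_CX \<sigma> \<longleftrightarrow>
    a \<in> ell1 \<and> (\<forall>n f. a n * int_funpow (\<alpha> \<sigma>) n f = f * a n)"
  by (auto simp: ell1_commutant_CX_def fun_eq_iff ell1_mult_embed_right[OF assms]
      ell1_mult_embed_left)

lemma ell1_mult_commutant_left:
  assumes "homeomorphism UNIV UNIV \<sigma> (inv \<sigma>)" and "a \<in> ell1_commutant_CX \<sigma>"
  shows "ell1_mult \<sigma> a b n = (\<Sum>\<^sub>\<infinity>k. a k * b (n - k))"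
proof -
  have "a k * int_funpow (\<alpha> \<sigma>) k (b (n - k)) = a k * b (n - k)" for k
    using assms(2) by (simp add: mem_ell1_commutant_CX_iff[OF assms(1)] mult.commute[of "a k"])
  then show ?thesis
    by (simp add: ell1_mult_def)
qed

lemma commutant_convolution_summable:
  assumes \<sigma>: "homeomorphism UNIV UNIV \<sigma> (inv \<sigma>)"
    and a: "a \<in> ell1_commutant_CX \<sigma>" and b: "b \<in> ell1"
  shows "(\<lambda>k. a k * b (n - k)) summable_on UNIV"
proof -
  have "(\<lambda>k. norm (a k * b (n - k))) summable_on UNIV"
    using ell1_mult_summable[OF \<sigma> _ b, of a n] a
    by (simp add: mem_ell1_commutant_CX_iff[OF \<sigma>] mult.commute)
  then show ?thesis
    by (rule abs_summable_summable)
qed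


section \<open>The commutant as a commutative Banach \<open>*\<close>-algebra\<close>

lemma ell1_commutant_CX_abelian:
  assumes "homeomorphism UNIV UNIV \<sigma> (inv \<sigma>)"
  shows "ell1_abelian \<sigma> (ell1_commutant_CX \<sigma>)"
  unfolding ell1_abelian_def
proof (intro ballI ext)
  fix a b n
  assume a: "a \<in> ell1_commutant_CX \<sigma>" and b: "b \<in> ell1_commutant_CX \<sigma>"
  have "bij (\<lambda>k::int. n - k)"
    by (rule bij_betwI[where g = "\<lambda>k. n - k"]) auto
  from infsum_reindex_bij_betw[OF this, of "\<lambda>k. a k * b (n - k)"]
  show "ell1_mult \<sigma> a b n = ell1_mult \<sigma> b a n"
    by (simp add: ell1_mult_commutant_left assms a b mult.commute)
qed

lemma ell1_add_mem:
  assumes "a \<in> ell1" "b \<in> ell1"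
  shows "(\<lambda>k. a k + b k) \<in> ell1"
  unfolding ell1_def mem_Collect_eq
proof (rule summable_on_comparison_test)
  show "(\<lambda>k. norm (a k) + norm (b k)) summable_on UNIV"
    using assms by (auto simp: ell1_def intro: summable_on_add)
qed (auto intro: norm_triangle_ineq)

lemma ell1_mult_pointwise_mem:
  assumes "a \<in> ell1"
  shows "(\<lambda>k. f * a k) \<in> ell1"
  unfolding ell1_def mem_Collect_eq
proof (rule summable_on_comparison_test)
  show "(\<lambda>k. norm f * norm (a k)) summable_on UNIV"
    using assms by (auto simp: ell1_def intro: summable_on_cmult_right)
qed (auto intro: norm_mult_ineq)

text \<open>
  In the untwisted product of \<open>a\<close> and \<open>b\<close>, splitting \<open>\<alpha>\<^sup>n\<close> as \<open>\<alpha>\<^sup>n\<^sup>-\<^sup>k \<circ> \<alpha>\<^sup>k\<close> lets \<open>b(n - k)\<close> absorb the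
  first factor and \<open>a(k)\<close> the second.
\<close>

lemma ell1_mult_mem_commutant:
  assumes \<sigma>: "homeomorphism UNIV UNIV \<sigma> (inv \<sigma>)"
    and a: "a \<in> ell1_commutant_CX \<sigma>" and b: "b \<in> ell1_commutant_CX \<sigma>"
  shows "ell1_mult \<sigma> a b \<in> ell1_commutant_CX \<sigma>"
proof -
  note iff = mem_ell1_commutant_CX_iff[OF \<sigma>]
  have ell1: "a \<in> ell1" "b \<in> ell1"
    using a b by (auto simp: iff)
  have "ell1_mult \<sigma> a b n * int_funpow (\<alpha> \<sigma>) n f = f * ell1_mult \<sigma> a b n" for n f
  proof -
    note sum = commutant_convolution_summable[OF \<sigma> a ell1(2), of n]
    have coeff: "a k * b (n - k) * int_funpow (\<alpha> \<sigma>) n f = f * (a k * b (n - k))" for k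
    proof -
      have "int_funpow (\<alpha> \<sigma>) n f = int_funpow (\<alpha> \<sigma>) (n - k) (int_funpow (\<alpha> \<sigma>) k f)"
        using int_funpow_add[OF bij_\<alpha>[OF \<sigma>], of "n - k" k f] by simp
      then have "a k * b (n - k) * int_funpow (\<alpha> \<sigma>) n f =
          a k * (int_funpow (\<alpha> \<sigma>) k f * b (n - k))"
        using b by (simp add: iff mult.assoc)
      also have "\<dots> = a k * int_funpow (\<alpha> \<sigma>) k f * b (n - k)"
        by (simp only: mult.assoc)
      also have "\<dots> = f * (a k * b (n - k))"
        using a by (simp add: iff mult.assoc)
      finally show ?thesis .
    qed
    have "ell1_mult \<sigma> a b n * int_funpow (\<alpha> \<sigma>) n f =
        (\<Sum>\<^sub>\<infinity>k. a k * b (n - k) * int_funpow (\<alpha> \<sigma>) n f)"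
      unfolding ell1_mult_commutant_left[OF \<sigma> a]
      by (rule infsum_cmult_left[symmetric]) (rule sum)
    also have "\<dots> = (\<Sum>\<^sub>\<infinity>k. f * (a k * b (n - k)))"
      by (simp only: coeff)
    also have "\<dots> = f * ell1_mult \<sigma> a b n"
      unfolding ell1_mult_commutant_left[OF \<sigma> a]
      by (rule infsum_cmult_right) (rule sum)
    finally show ?thesis .
  qed
  then show ?thesis
    by (simp add: iff ell1_mult_mem[OF \<sigma> ell1])
qed

lemma ell1_commutant_CX_subalgebra:
  assumes "homeomorphism UNIV UNIV \<sigma> (inv \<sigma>)"
  shows "ell1_subalgebra \<sigma> (ell1_commutant_CX \<sigma>)"
proof -
  note iff = mem_ell1_commutant_CX_iff[OF assms]
  have "(\<lambda>_. 0) \<in> ell1_commutant_CX \<sigma>"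
    by (simp add: iff) (simp add: ell1_def)
  moreover have "(\<lambda>k. a k + b k) \<in> ell1_commutant_CX \<sigma>"
    if "a \<in> ell1_commutant_CX \<sigma>" "b \<in> ell1_commutant_CX \<sigma>" for a b
    using that by (simp add: iff ell1_add_mem distrib_left distrib_right)
  moreover have "(\<lambda>k. g * a k) \<in> ell1_commutant_CX \<sigma>"
    if a: "a \<in> ell1_commutant_CX \<sigma>" for g a
  proof -
    have "g * a n * int_funpow (\<alpha> \<sigma>) n f = f * (g * a n)" for n f
    proof -
      have "g * a n * int_funpow (\<alpha> \<sigma>) n f = g * (f * a n)"
        using a by (simp add: iff mult.assoc)
      then show ?thesis
        by (simp only: mult.left_commute)
    qed
    then show ?thesis
      using a by (simp add: iff ell1_mult_pointwise_mem)
  qed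
  moreover have "ell1_commutant_CX \<sigma> \<subseteq> ell1"
    by (auto simp: iff)
  ultimately show ?thesis
    by (auto simp: ell1_subalgebra_def ell1_mult_mem_commutant[OF assms])
qed

lemma ell1_star_mem:
  assumes "homeomorphism UNIV UNIV \<sigma> (inv \<sigma>)" and "a \<in> ell1"
  shows "ell1_star \<sigma> a \<in> ell1"
proof -
  have "bij (uminus :: int \<Rightarrow> int)"
    by (rule bij_betwI[where g = uminus]) auto
  from summable_on_reindex_bij_betw[OF this, of "\<lambda>k. norm (a k)"] show ?thesis
    using assms(2)
    by (simp add: ell1_def ell1_star_def norm_cnj_bcontfun norm_int_funpow_\<alpha>[OF assms(1)])
qed

text \<open>
  Applying \<open>\<alpha>\<^sup>n\<close> to the criterion for \<open>a(-n)\<close> moves the twist to the other side, which gives the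
  criterion for \<open>\<alpha>\<^sup>n(a(-n))\<close> at \<open>n\<close>; conjugation only replaces \<open>f\<close> by its conjugate.
\<close>

lemma ell1_star_mem_commutant:
  assumes \<sigma>: "homeomorphism UNIV UNIV \<sigma> (inv \<sigma>)" and a: "a \<in> ell1_commutant_CX \<sigma>"
  shows "ell1_star \<sigma> a \<in> ell1_commutant_CX \<sigma>"
proof -
  note iff = mem_ell1_commutant_CX_iff[OF \<sigma>]
  have "ell1_star \<sigma> a n * int_funpow (\<alpha> \<sigma>) n f = f * ell1_star \<sigma> a n" for n f
  proof -
    let ?g = "cnj_bcontfun f" and ?A = "int_funpow (\<alpha> \<sigma>) n"
    have "?A (int_funpow (\<alpha> \<sigma>) (- n) ?g) = ?g"
      using int_funpow_add[OF bij_\<alpha>[OF \<sigma>], of n "- n" ?g] by simp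
    moreover have "?A (a (- n) * int_funpow (\<alpha> \<sigma>) (- n) ?g) = ?A (?g * a (- n))"
      using a by (simp add: iff)
    ultimately have "?A (a (- n)) * ?A ?g = ?g * ?A (a (- n))"
      by (simp add: int_funpow_\<alpha>_mult[OF \<sigma>] mult.commute)
    then have "cnj_bcontfun (?A (a (- n)) * ?A ?g) = cnj_bcontfun (?g * ?A (a (- n)))"
      by simp
    then show ?thesis
      by (simp add: ell1_star_def cnj_bcontfun_mult int_funpow_\<alpha>_cnj[OF \<sigma>] cnj_bcontfun_cnj)
  qed
  then show ?thesis
    using a by (simp add: iff ell1_star_mem[OF \<sigma>])
qed

lemma norm_coeff_le_ell1_dist:
  assumes "a \<in> ell1" "b \<in> ell1"
  shows "norm (a n - b n) \<le> ell1_dist a b"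
proof -
  have "norm (a n - b n) = (\<Sum>\<^sub>\<infinity>k\<in>{n}. norm (a k - b k))"
    by simp
  also have "\<dots> \<le> ell1_dist a b"
    unfolding ell1_dist_def ell1_norm_def
    by (rule infsum_mono2) (auto intro: ell1_diff[OF assms])
  finally show ?thesis .
qed

text \<open>
  If \<open>a\<close> violates the criterion at \<open>n\<close> and \<open>f\<close> with defect \<open>c\<close>, then so does every \<open>b\<close> close
  to \<open>a\<close>, because the defect changes by at most \<open>2 \<cdot> \<parallel>f\<parallel> \<cdot> \<parallel>a - b\<parallel>\<close>.
\<close>

lemma ell1_commutant_CX_closed:
  assumes \<sigma>: "homeomorphism UNIV UNIV \<sigma> (inv \<sigma>)"
  shows "closedin (Metric_space.mtopology ell1 ell1_dist) (ell1_commutant_CX \<sigma>)"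
proof -
  interpret Metric_space "ell1 :: (int \<Rightarrow> 'a \<Rightarrow>\<^sub>C complex) set" ell1_dist
    by (rule ell1_Metric_space)
  note iff = mem_ell1_commutant_CX_iff[OF \<sigma>]
  show ?thesis
    unfolding closedin_metric
  proof (intro conjI allI impI)
    show "ell1_commutant_CX \<sigma> \<subseteq> ell1"
      by (auto simp: iff)
    fix a assume "a \<in> ell1 - ell1_commutant_CX \<sigma>"
    then obtain n f where a: "a \<in> ell1" and nf: "a n * int_funpow (\<alpha> \<sigma>) n f \<noteq> f * a n"
      by (auto simp: iff)
    define c where "c = a n * int_funpow (\<alpha> \<sigma>) n f - f * a n"
    \<comment> \<open>The summand 1 keeps the denominator positive without a case distinction on \<open>f\<close>.\<close>
    define r where "r = norm c / (2 * norm f + 1)"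
    have pos: "0 < 2 * norm f + 1"
      using norm_ge_zero[of f] by linarith
    have c: "norm c = r * (2 * norm f + 1)"
      using pos by (simp add: r_def)
    have r: "0 < r"
      using nf pos by (simp add: r_def c_def)
    have "b \<notin> mball a r" if b: "b \<in> ell1_commutant_CX \<sigma>" for b
    proof
      assume "b \<in> mball a r"
      then have dist: "norm (a n - b n) < r"
        using norm_coeff_le_ell1_dist[of a b n] by (auto simp: mball_def)
      have "b n * int_funpow (\<alpha> \<sigma>) n f = f * b n"
        using b by (simp add: iff)
      then have "c = (a n - b n) * int_funpow (\<alpha> \<sigma>) n f - f * (a n - b n)"
        by (simp add: c_def algebra_simps)
      also have "norm \<dots> \<le> norm (a n - b n) * norm f + norm f * norm (a n - b n)"
        using norm_mult_ineq[of "a n - b n" "int_funpow (\<alpha> \<sigma>) n f"] norm_mult_ineq[of f "a n - b n"]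
        unfolding norm_int_funpow_\<alpha>[OF \<sigma>]
        by (intro order_trans[OF norm_triangle_ineq4] add_mono)
      also have "\<dots> = norm (a n - b n) * (2 * norm f)"
        by simp
      also have "\<dots> \<le> r * (2 * norm f)"
        using dist by (intro mult_right_mono) auto
      finally show False
        using c r by (simp add: algebra_simps)
    qed
    then show "\<exists>r>0. disjnt (ell1_commutant_CX \<sigma>) (mball a r)"
      using r by (intro exI[of _ r]) (auto simp: disjnt_iff simp del: in_mball)
  qed
qed

lemma range_ell1_embed_subset_commutant:
  assumes "homeomorphism UNIV UNIV \<sigma> (inv \<sigma>)"
  shows "range ell1_embed \<subseteq> ell1_commutant_CX \<sigma>"
proof (rule image_subsetI)
  fix f :: "'a \<Rightarrow>\<^sub>C complex"
  have "ell1_embed f n * int_funpow (\<alpha> \<sigma>) n g = g * ell1_embed f n" for n g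
    by (simp add: ell1_embed_def mult.commute)
  then show "ell1_embed f \<in> ell1_commutant_CX \<sigma>"
    by (simp add: mem_ell1_commutant_CX_iff[OF assms] ell1_embed_mem)
qed

lemma abelian_over_CX_subset_commutant:
  assumes "B \<subseteq> ell1" and "ell1_abelian \<sigma> B" and "range ell1_embed \<subseteq> B"
  shows "B \<subseteq> ell1_commutant_CX \<sigma>"
proof
  fix b assume b: "b \<in> B"
  then have "ell1_mult \<sigma> b (ell1_embed f) = ell1_mult \<sigma> (ell1_embed f) b" for f
    using assms(2,3) unfolding ell1_abelian_def by blast
  then show "b \<in> ell1_commutant_CX \<sigma>"
    using b assms(1) by (auto simp: ell1_commutant_CX_def)
qed

lemma ell1_commutant_CX_unital:
  assumes "homeomorphism UNIV UNIV \<sigma> (inv \<sigma>)"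
  shows "ell1_unital \<sigma> (ell1_commutant_CX \<sigma>)"
  unfolding ell1_unital_def
proof (intro bexI ballI conjI ext)
  show "ell1_embed 1 \<in> ell1_commutant_CX \<sigma>"
    using range_ell1_embed_subset_commutant[OF assms] by blast
qed (simp_all add: ell1_mult_embed_left ell1_mult_embed_right[OF assms] int_funpow_\<alpha>_one[OF assms])

theorem proposition3p2:
  fixes \<sigma> :: "'x::t2_space \<Rightarrow> 'x"
  assumes "compact (UNIV :: 'x set)"
    and "homeomorphism UNIV UNIV \<sigma> (inv \<sigma>)"
  shows "ell1_abelian \<sigma> (ell1_commutant_CX \<sigma>) \<and>
    ell1_largest_abelian_over_CX \<sigma> (ell1_commutant_CX \<sigma>) \<and>
    ell1_Banach_star_subalgebra \<sigma> (ell1_commutant_CX \<sigma>) \<and>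
    ell1_unital \<sigma> (ell1_commutant_CX \<sigma>)"
proof -
  note \<sigma> = assms(2)
  have "B \<subseteq> ell1_commutant_CX \<sigma>"
    if "ell1_subalgebra \<sigma> B \<and> ell1_abelian \<sigma> B \<and> range ell1_embed \<subseteq> B" for B
    using that by (intro abelian_over_CX_subset_commutant) (auto simp: ell1_subalgebra_def)
  then show ?thesis
    unfolding ell1_largest_abelian_over_CX_def ell1_Banach_star_subalgebra_def
    using ell1_commutant_CX_abelian[OF \<sigma>] ell1_commutant_CX_subalgebra[OF \<sigma>]
      range_ell1_embed_subset_commutant[OF \<sigma>] ell1_commutant_CX_closed[OF \<sigma>]
      ell1_star_mem_commutant[OF \<sigma>] ell1_commutant_CX_unital[OF \<sigma>]
    by blast
qed

end
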